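(* Let $P=\omega_0P_0+\omega_1P_1+\omega_2P_2$, where $P_0,P_1,P_2$ are the polynomials defined in the context from the cell averages of $u$, and where the ($h$-dependent) weights satisfy $\omega_i\ge0$, $\omega_0+\omega_1+\omega_2=1$. Let $u$ be smooth in the stencil $S_1=I_{0.5}\cup I_{1.5}$ and contain a discontinuity, located at $x^*$, in $I_{2.5}$. If, as $h\to0$, $$\omega_0=O(h),\qquad \omega_1=O(1),\qquad \omega_2=O(h^2),$$ then $$u(x)-P(x)=O(h^2)\qquad\forall x\in S_1,$$ and this estimate even holds for all $x$ up to the position $x^*$ of the discontinuity (i.e. for all $x\in[x_0,x^* )$) if $u$ is sufficiently smooth there.
   Context: Grid: $h>0$ is the mesh size, $x_0\in\mathbb{R}$ the left boundary point, $x_j=x_0+jh$ (for integer and half-integer $j$), and for $j\in\{0.5,1.5,2.5\}$ the cells are $I_j=[x_j-\tfrac h2,x_j+\tfrac h2]$. Stencils: $S_0=I_{0.5}$, $S_1=I_{0.5}\cup I_{1.5}$, $S_2=I_{0.5}\cup I_{1.5}\cup I_{2.5}$. Cell averages: $\bar u_j=\frac1h\int_{I_j}u(x)\,dx$. Polynomials: with $\sigma_l=\bar u_{1.5}-\bar u_{0.5}$ and $\sigma_r=\bar u_{2.5}-\bar u_{1.5}$, $$P_0(x)=\bar u_{0.5},\qquad P_1(x)=\bar u_{1.5}+\frac{\sigma_l}{h}(x-x_{1.5}),$$ $$P_2(x)=\frac1{c_2}\Big(-c_0\bar u_{0.5}+(1-c_1)\bar u_{1.5}-\tfrac1{24}(\sigma_r-\sigma_l)+\frac{\sigma_r+\sigma_l-2c_1\sigma_l}{2h}(x-x_{1.5})+\frac{\sigma_r-\sigma_l}{2h^2}(x-x_{1.5})^2\Big),$$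 where $c_0=K_0h^{\gamma_0}$, $c_1=K_1h^{\gamma_1}$, $c_2=1-K_0h^{\gamma_0}-K_1h^{\gamma_1}$ with fixed $K_0,K_1\in\mathbb{R}_{>0}$, $\gamma_0,\gamma_1\in\mathbb{R}_{\ge0}$, $\gamma_0\ge\gamma_1$, $\gamma_0\ge1$, and $c_i>0$ for all sufficiently small $h$. Asymptotics: all $O(\cdot)$ are for $h\to0$ with $u$ and the parameters fixed, and estimates in $x$ are uniform. The function $u$ is fixed, bounded, and has near $x^*$ a single (jump) discontinuity, at $x^*$, being smooth on both sides of it; the grid origin $x_0=x_0(h)$ depends on $h$ so that $x^*$ lies in $I_{2.5}$ for every $h$ under consideration (for instance $x_0=x^*-2.5h$). Smoothness on the $h$-dependent stencil means $C^k$ with $k$ sufficiently large and with derivative bounds uniform in $h$. *)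

theory Defs
  imports "HOL-Analysis.Analysis" "HOL-Library.Landau_Symbols"
begin

section \<open>Smoothness\<close>

text \<open>\<open>D i\<close> plays the role of the \<open>i\<close>-th derivative of \<open>u\<close> on \<open>S\<close>. Derivatives are taken
  within \<open>S\<close>, hence one-sided at those endpoints of an interval that belong to it. Continuity
  of the derivatives of order less than \<open>k\<close> is automatic.\<close>

definition Ck_derivs :: "nat \<Rightarrow> real set \<Rightarrow> (real \<Rightarrow> real) \<Rightarrow> (nat \<Rightarrow> real \<Rightarrow> real) \<Rightarrow> bool" where
  "Ck_derivs k S u D \<longleftrightarrow>
     (\<forall>x\<in>S. D 0 x = u x) \<and>
     (\<forall>i<k. \<forall>x\<in>S. (D i has_real_derivative D (Suc i) x) (at x within S)) \<and>
     continuous_on S (D k)"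

definition Ck_on :: "nat \<Rightarrow> real set \<Rightarrow> (real \<Rightarrow> real) \<Rightarrow> bool" where
  "Ck_on k S u \<longleftrightarrow> (\<exists>D. Ck_derivs k S u D)"

definition Ck_bounded_on :: "nat \<Rightarrow> real \<Rightarrow> real set \<Rightarrow> (real \<Rightarrow> real) \<Rightarrow> bool" where
  "Ck_bounded_on k B S u \<longleftrightarrow>
     (\<exists>D. Ck_derivs k S u D \<and> (\<forall>i\<le>k. \<forall>x\<in>S. \<bar>D i x\<bar> \<le> B))"

text \<open>Smoothness on sets \<open>S h\<close> that vary with the mesh size \<open>h\<close> in \<open>(0, h0)\<close>: the bound
  on the derivatives does not depend on \<open>h\<close>.\<close>

definition uniformly_Ck_on :: "nat \<Rightarrow> real \<Rightarrow> (real \<Rightarrow> real set) \<Rightarrow> (real \<Rightarrow> real) \<Rightarrow> bool" where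
  "uniformly_Ck_on k h0 S u \<longleftrightarrow> (\<exists>B. \<forall>h\<in>{0<..<h0}. Ck_bounded_on k B (S h) u)"

definition has_jump_at :: "(real \<Rightarrow> real) \<Rightarrow> real \<Rightarrow> bool" where
  "has_jump_at u xs \<longleftrightarrow>
     (\<exists>L R. (u \<longlongrightarrow> L) (at_left xs) \<and> (u \<longlongrightarrow> R) (at_right xs) \<and> L \<noteq> R)"

text \<open>Near \<open>xs\<close> the function \<open>u\<close> has a single discontinuity, a jump at \<open>xs\<close>, and it is smooth
  on both sides of \<open>xs\<close>. The value \<open>u xs\<close> is arbitrary.\<close>

definition single_jump_at :: "nat \<Rightarrow> (real \<Rightarrow> real) \<Rightarrow> real \<Rightarrow> bool" where
  "single_jump_at k u xs \<longleftrightarrow> has_jump_at u xs \<and>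
     (\<exists>\<delta>>0. Ck_on k {xs - \<delta><..<xs} u \<and> Ck_on k {xs<..<xs + \<delta>} u)"


section \<open>Grid, stencils and cell averages\<close>

text \<open>The index \<open>j\<close> of a node is real, since half-integers occur.\<close>

definition node :: "real \<Rightarrow> real \<Rightarrow> real \<Rightarrow> real" where
  "node x0 h j = x0 + j * h"

definition cell :: "real \<Rightarrow> real \<Rightarrow> real \<Rightarrow> real set" where
  "cell x0 h j = {node x0 h j - h / 2 .. node x0 h j + h / 2}"

definition stencil :: "nat \<Rightarrow> real \<Rightarrow> real \<Rightarrow> real set" where
  "stencil r x0 h = (\<Union>i\<le>r. cell x0 h (real i + 1 / 2))"

definition cell_avg :: "(real \<Rightarrow> real) \<Rightarrow> real \<Rightarrow> real \<Rightarrow> real \<Rightarrow> real" where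
  "cell_avg u x0 h j = (1 / h) * integral (cell x0 h j) u"

definition sigma_l :: "(real \<Rightarrow> real) \<Rightarrow> real \<Rightarrow> real \<Rightarrow> real" where
  "sigma_l u x0 h = cell_avg u x0 h (3 / 2) - cell_avg u x0 h (1 / 2)"

definition sigma_r :: "(real \<Rightarrow> real) \<Rightarrow> real \<Rightarrow> real \<Rightarrow> real" where
  "sigma_r u x0 h = cell_avg u x0 h (5 / 2) - cell_avg u x0 h (3 / 2)"


section \<open>Reconstruction polynomials\<close>

definition coef :: "real \<Rightarrow> real \<Rightarrow> real \<Rightarrow> real" where
  "coef K \<gamma> h = K * h powr \<gamma>"

definition coef2 :: "real \<Rightarrow> real \<Rightarrow> real \<Rightarrow> real \<Rightarrow> real \<Rightarrow> real" where
  "coef2 K0 \<gamma>0 K1 \<gamma>1 h = 1 - K0 * h powr \<gamma>0 - K1 * h powr \<gamma>1"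

definition P0 :: "(real \<Rightarrow> real) \<Rightarrow> real \<Rightarrow> real \<Rightarrow> real \<Rightarrow> real" where
  "P0 u x0 h x = cell_avg u x0 h (1 / 2)"

definition P1 :: "(real \<Rightarrow> real) \<Rightarrow> real \<Rightarrow> real \<Rightarrow> real \<Rightarrow> real" where
  "P1 u x0 h x =
     cell_avg u x0 h (3 / 2) + sigma_l u x0 h / h * (x - node x0 h (3 / 2))"

definition P2 ::
  "real \<Rightarrow> real \<Rightarrow> real \<Rightarrow> real \<Rightarrow> (real \<Rightarrow> real) \<Rightarrow> real \<Rightarrow> real \<Rightarrow> real \<Rightarrow> real" where
  "P2 K0 \<gamma>0 K1 \<gamma>1 u x0 h x =
     (let c0 = coef K0 \<gamma>0 h; c1 = coef K1 \<gamma>1 h; c2 = coef2 K0 \<gamma>0 K1 \<gamma>1 h;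
          sl = sigma_l u x0 h; sr = sigma_r u x0 h; y = x - node x0 h (3 / 2)
      in 1 / c2 *
         (- c0 * cell_avg u x0 h (1 / 2) + (1 - c1) * cell_avg u x0 h (3 / 2)
          - 1 / 24 * (sr - sl)
          + (sr + sl - 2 * c1 * sl) / (2 * h) * y
          + (sr - sl) / (2 * h\<^sup>2) * y\<^sup>2))"

end

theory Submission
  imports Defs
begin

text \<open>Because the weights sum to one, the error splits as
  \<open>u - P = \<omega>0 (u - P0) + \<omega>1 (u - P1) + \<omega>2 (u - P2)\<close>, and each summand is of order \<open>h\<^sup>2\<close> for a
  reason of its own.

  For \<open>P0\<close> and \<open>P1\<close>, compare \<open>u\<close> with its tangent line at the left boundary point \<open>x0\<close>; on a
  smooth interval of length at most \<open>3 h\<close> they differ by \<open>O(h\<^sup>2)\<close>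
  (\<open>tangent_line_error\<close>). Cell averages reproduce affine functions at cell midpoints, so \<open>P1\<close>
  reproduces the tangent line up to a multiple of the same error (\<open>P1_error\<close>), whereas the
  constant \<open>P0\<close> misses its slope and is only accurate to \<open>O(h)\<close> (\<open>P0_error\<close>); the weight
  \<open>\<omega>0 = O(h)\<close> supplies the missing order.

  For \<open>P2\<close>, whose data see the discontinuity, nothing better than boundedness is available: the
  cell averages are bounded because \<open>u\<close> is, the powers of \<open>1 / h\<close> in the coefficients are
  cancelled by powers of \<open>x - node x0 h (3 / 2)\<close>, and \<open>1 / c\<^sub>2\<close> stays bounded
  (\<open>P2_bound\<close>, \<open>coef2_bounded_below\<close>). The weight \<open>\<omega>2 = O(h\<^sup>2)\<close> does the rest.

  The averages entering \<open>P0\<close> and \<open>P1\<close> only use the first two cells, while the tangent line is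
  a good approximation wherever smoothness reaches. The estimate is therefore proved on any
  interval lying between \<open>[x0, x0 + 2 h)\<close> and \<open>[x0, x0 + 3 h]\<close>
  (\<open>reconstruction_error\<close>), which covers both \<open>S\<^sub>1\<close> and the interval up to the
  discontinuity.\<close>

section \<open>Cell averages\<close>

lemma cell_half_integer:
  "cell x0 h (1 / 2) = {x0..x0 + h}"
  "cell x0 h (3 / 2) = {x0 + h..x0 + 2 * h}"
  "cell x0 h (5 / 2) = {x0 + 2 * h..x0 + 3 * h}"
  by (auto simp: cell_def node_def field_simps)

lemma stencil_1_eq:
  assumes "0 < h"
  shows "stencil 1 x0 h = {x0..x0 + 2 * h}"
proof -
  have "{..1::nat} = {0, 1}" by auto
  then have "stencil 1 x0 h = cell x0 h (1 / 2) \<union> cell x0 h (3 / 2)"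
    by (simp add: stencil_def)
  also have "\<dots> = {x0..x0 + 2 * h}"
    using assms by (auto simp: cell_half_integer)
  finally show ?thesis .
qed

text \<open>This holds across a discontinuity too: an integrable \<open>u\<close> has an integral of size at most
  \<open>M h\<close>, and the integral of a non-integrable function is \<open>0\<close> by convention.\<close>

lemma abs_cell_avg_le:
  assumes h: "0 < h" and M: "\<And>x. \<bar>u x\<bar> \<le> M"
  shows "\<bar>cell_avg u x0 h j\<bar> \<le> M"
proof -
  have "0 \<le> M" using M[of 0] by linarith
  have "norm (integral (cell x0 h j) u) \<le> M * h"
  proof (cases "u integrable_on cell x0 h j")
    case True
    have "norm (integral (cell x0 h j) u) \<le> integral (cell x0 h j) (\<lambda>_. M)"
      using True M unfolding cell_def by (intro integral_norm_bound_integral) auto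
    also have "\<dots> = M * h" using h by (simp add: cell_def)
    finally show ?thesis .
  next
    case False
    then show ?thesis using \<open>0 \<le> M\<close> h by (simp add: not_integrable_integral)
  qed
  then show ?thesis using h by (simp add: cell_avg_def field_simps abs_mult)
qed

text \<open>The average of an affine function is its value at the midpoint of the cell. The endpoints
  of the cell form a null set and are left out because the discontinuity may sit at the right
  end of the second cell.\<close>

lemma cell_avg_affine_error:
  assumes h: "0 < h" and int: "u integrable_on cell x0 h j"
    and E: "\<And>x. x \<in> {node x0 h j - h / 2<..<node x0 h j + h / 2} \<Longrightarrow>
              \<bar>u x - (a + b * (x - node x0 h j))\<bar> \<le> E"
  shows "\<bar>cell_avg u x0 h j - a\<bar> \<le> E"
proof -
  define m where "m = node x0 h j"
  define l where "l = (\<lambda>x. a + b * (x - m))"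
  have cell: "cell x0 h j = {m - h / 2..m + h / 2}" by (simp add: cell_def m_def)
  have "((\<lambda>x. l x) has_integral
      (a * (m + h / 2) + b / 2 * (m + h / 2 - m)\<^sup>2) - (a * (m - h / 2) + b / 2 * (m - h / 2 - m)\<^sup>2))
      {m - h / 2..m + h / 2}"
    using h unfolding l_def
    by (intro fundamental_theorem_of_calculus)
       (auto intro!: derivative_eq_intros simp flip: has_real_derivative_iff_has_vector_derivative)
  then have l: "(l has_integral (h * a)) {m - h / 2..m + h / 2}"
    by (simp add: power2_eq_square algebra_simps)
  have u: "u integrable_on {m - h / 2..m + h / 2}" using int cell by simp
  have "norm (integral {m - h / 2<..<m + h / 2} (\<lambda>x. u x - l x))
      \<le> integral {m - h / 2<..<m + h / 2} (\<lambda>_. E)"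
  proof (intro integral_norm_bound_integral)
    show "(\<lambda>x. u x - l x) integrable_on {m - h / 2<..<m + h / 2}"
      using integrable_diff[OF u has_integral_integrable[OF l]]
      by (simp add: integrable_on_Icc_iff_Ioo)
    show "(\<lambda>_. E) integrable_on {m - h / 2<..<m + h / 2}"
      using integrable_const_ivl[of E] integrable_on_Icc_iff_Ioo by blast
  qed (use E in \<open>auto simp: l_def m_def\<close>)
  also have "integral {m - h / 2<..<m + h / 2} (\<lambda>_. E) = h * E"
    using h by (simp add: integral_open_interval_real[symmetric])
  also have "integral {m - h / 2<..<m + h / 2} (\<lambda>x. u x - l x) = integral {m - h / 2..m + h / 2} u - h * a"
    using integral_diff[OF u has_integral_integrable[OF l]] l
    by (simp add: integral_open_interval_real[symmetric] integral_unique)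
  also have "\<dots> = h * (cell_avg u x0 h j - a)"
    using h by (simp add: cell_avg_def cell field_simps)
  finally show ?thesis using h by (simp add: abs_mult)
qed

section \<open>The polynomials determined by the smooth cells\<close>

text \<open>Taylor expansion of first order; the factor \<open>9\<close> comes from \<open>\<bar>x - x0\<bar> \<le> 3 h\<close>.\<close>

lemma tangent_line_error:
  assumes k: "2 \<le> k" and D: "Ck_derivs k T u D" and B: "\<forall>i\<le>k. \<forall>x\<in>T. \<bar>D i x\<bar> \<le> B"
    and T: "convex T" "T \<subseteq> {x0..x0 + 3 * h}" and x0: "x0 \<in> T" and x: "x \<in> T"
  shows "\<bar>u x - (u x0 + D 1 x0 * (x - x0))\<bar> \<le> 9 * B * h\<^sup>2"
proof -
  have "0 \<le> B" using B x0 by (force intro: order_trans[OF abs_ge_zero])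
  have "norm (D 0 x - (\<Sum>i\<le>1. D i x0 * (x - x0) ^ i / fact i)) \<le> B * norm (x - x0) ^ Suc 1 / fact 1"
    by (rule field_Taylor[OF T(1) _ _ x0 x]) (use k D B in \<open>auto simp: Ck_derivs_def\<close>)
  also have "\<dots> \<le> B * (3 * h) ^ Suc 1 / fact 1"
    using x T(2) \<open>0 \<le> B\<close> by (intro divide_right_mono mult_left_mono power_mono) auto
  also have "\<dots> = 9 * B * h\<^sup>2" by (simp add: power2_eq_square)
  finally show ?thesis using D x0 x by (simp add: Ck_derivs_def)
qed

context
  fixes u :: "real \<Rightarrow> real" and x0 h a b E x :: real
  assumes h: "0 < h"
    and int: "u integrable_on cell x0 h (1 / 2)" "u integrable_on cell x0 h (3 / 2)"
    and near: "\<forall>t\<in>{x0..<x0 + 2 * h}. \<bar>u t - (a + b * (t - x0))\<bar> \<le> E"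
    and x: "x \<in> {x0..x0 + 3 * h}" and near_x: "\<bar>u x - (a + b * (x - x0))\<bar> \<le> E"
begin

lemma cell_avg_first: "\<bar>cell_avg u x0 h (1 / 2) - (a + b * (h / 2))\<bar> \<le> E"
proof (rule cell_avg_affine_error[where b = b])
  fix t assume "t \<in> {node x0 h (1 / 2) - h / 2<..<node x0 h (1 / 2) + h / 2}"
  then show "\<bar>u t - (a + b * (h / 2) + b * (t - node x0 h (1 / 2)))\<bar> \<le> E"
    using bspec[OF near, of t] h by (simp add: node_def algebra_simps)
qed (use h int in auto)

lemma cell_avg_second: "\<bar>cell_avg u x0 h (3 / 2) - (a + b * (3 * h / 2))\<bar> \<le> E"
proof (rule cell_avg_affine_error[where b = b])
  fix t assume "t \<in> {node x0 h (3 / 2) - h / 2<..<node x0 h (3 / 2) + h / 2}"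
  then show "\<bar>u t - (a + b * (3 * h / 2) + b * (t - node x0 h (3 / 2)))\<bar> \<le> E"
    using bspec[OF near, of t] h by (simp add: node_def algebra_simps)
qed (use h int in auto)

lemma P0_error: "\<bar>u x - P0 u x0 h x\<bar> \<le> 2 * E + 3 * \<bar>b\<bar> * h"
proof -
  have "\<bar>b * (x - x0 - h / 2)\<bar> \<le> \<bar>b\<bar> * (3 * h)"
    using x h unfolding abs_mult by (intro mult_left_mono) auto
  moreover have "u x - P0 u x0 h x = (u x - (a + b * (x - x0))) + b * (x - x0 - h / 2)
      - (cell_avg u x0 h (1 / 2) - (a + b * (h / 2)))"
    by (simp add: P0_def algebra_simps)
  ultimately show ?thesis using cell_avg_first near_x by (simp add: abs_le_iff)
qed

text \<open>\<open>P1\<close> depends linearly on the two averages and reproduces affine functions. Hence only the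
  errors \<open>e0\<close>, \<open>e1\<close> of the averages matter; they enter with factors of size at most
  \<open>3 / 2\<close> and \<open>5 / 2\<close>, and the distance of \<open>u x\<close> from the line adds a fifth \<open>E\<close>.\<close>

lemma P1_error: "\<bar>u x - P1 u x0 h x\<bar> \<le> 5 * E"
proof -
  define e0 where "e0 = cell_avg u x0 h (1 / 2) - (a + b * (h / 2))"
  define e1 where "e1 = cell_avg u x0 h (3 / 2) - (a + b * (3 * h / 2))"
  define s where "s = (x - node x0 h (3 / 2)) / h"
  have s: "\<bar>s\<bar> \<le> 3 / 2" using x h by (auto simp: s_def node_def abs_le_iff field_simps)
  have e: "\<bar>e0\<bar> \<le> E" "\<bar>e1\<bar> \<le> E" using cell_avg_first cell_avg_second by (auto simp: e0_def e1_def)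
  have "P1 u x0 h x - (a + b * (x - x0)) = e1 + (e1 - e0) * s"
    using h by (simp add: P1_def sigma_l_def e0_def e1_def s_def node_def field_simps)
  moreover have "\<bar>(e1 - e0) * s\<bar> \<le> (2 * E) * (3 / 2)"
    using e s unfolding abs_mult by (intro mult_mono) auto
  ultimately show ?thesis using near_x e by (simp add: abs_le_iff)
qed

end

section \<open>The polynomial that sees the discontinuity\<close>

text \<open>With the normalised variable \<open>s = (x - node x0 h (3 / 2)) / h\<close>, which has size at most
  \<open>3 / 2\<close>, no negative power of \<open>h\<close> remains. The five terms of the numerator are then at most
  \<open>M\<close>, \<open>M\<close>, \<open>M\<close>, \<open>3 M\<close> and \<open>9 M / 2\<close>.\<close>

lemma P2_bound:
  assumes h: "0 < h" and M: "\<And>x. \<bar>u x\<bar> \<le> M" and x: "x \<in> {x0..x0 + 3 * h}"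
    and c: "0 < coef K0 \<gamma>0 h" "0 < coef K1 \<gamma>1 h" and \<kappa>: "0 < \<kappa>" "\<kappa> \<le> coef2 K0 \<gamma>0 K1 \<gamma>1 h"
  shows "\<bar>P2 K0 \<gamma>0 K1 \<gamma>1 u x0 h x\<bar> \<le> 11 * M / \<kappa>"
proof -
  define c0 c1 c2 where "c0 = coef K0 \<gamma>0 h" and "c1 = coef K1 \<gamma>1 h"
    and "c2 = coef2 K0 \<gamma>0 K1 \<gamma>1 h"
  define v0 v1 v2 where "v0 = cell_avg u x0 h (1 / 2)" and "v1 = cell_avg u x0 h (3 / 2)"
    and "v2 = cell_avg u x0 h (5 / 2)"
  define sl sr where "sl = v1 - v0" and "sr = v2 - v1"
  define s where "s = (x - node x0 h (3 / 2)) / h"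
  have M0: "0 \<le> M" using M[of 0] by linarith
  have v: "\<bar>v0\<bar> \<le> M" "\<bar>v1\<bar> \<le> M" "\<bar>v2\<bar> \<le> M"
    using abs_cell_avg_le[of h u M, OF h M] by (auto simp: v0_def v1_def v2_def)
  \<comment> \<open>Positivity of all three coefficients, which sum to one, confines them to \<open>[0, 1]\<close>.\<close>
  have "c0 + c1 + c2 = 1" by (simp add: c0_def c1_def c2_def coef_def coef2_def)
  then have c01: "0 \<le> c0" "c0 \<le> 1" "0 \<le> c1" "c1 \<le> 1"
    using c \<kappa> by (auto simp: c0_def[symmetric] c1_def[symmetric] c2_def[symmetric])
  have sl: "\<bar>sl\<bar> \<le> 2 * M" and sr: "\<bar>sr\<bar> \<le> 2 * M" using v by (auto simp: sl_def sr_def)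
  have s: "\<bar>s\<bar> \<le> 3 / 2" using x h by (auto simp: s_def node_def abs_le_iff field_simps)
  have "\<bar>s\<bar>\<^sup>2 \<le> (3 / 2)\<^sup>2" using s by (intro power_mono) auto
  then have s2: "\<bar>s\<^sup>2\<bar> \<le> 9 / 4" by (simp add: power2_eq_square)
  define N where "N = - c0 * v0 + (1 - c1) * v1 - 1 / 24 * (sr - sl)
      + (sr + sl - 2 * c1 * sl) / 2 * s + (sr - sl) / 2 * s\<^sup>2"
  have P2: "P2 K0 \<gamma>0 K1 \<gamma>1 u x0 h x = N / c2"
    using h by (simp add: P2_def Let_def N_def c0_def c1_def c2_def s_def sl_def sr_def
        v0_def v1_def v2_def sigma_l_def sigma_r_def power_divide)
  have t1: "\<bar>c0 * v0\<bar> \<le> 1 * M" using c01 v unfolding abs_mult by (intro mult_mono) auto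
  have t2: "\<bar>(1 - c1) * v1\<bar> \<le> 1 * M" using c01 v unfolding abs_mult by (intro mult_mono) auto
  have "\<bar>(1 - 2 * c1) * sl\<bar> \<le> 1 * (2 * M)"
    using c01 sl unfolding abs_mult by (intro mult_mono) auto
  then have "\<bar>(sr + sl - 2 * c1 * sl) / 2\<bar> \<le> 2 * M"
    using sr by (simp add: algebra_simps abs_le_iff)
  then have t3: "\<bar>(sr + sl - 2 * c1 * sl) / 2 * s\<bar> \<le> (2 * M) * (3 / 2)"
    using s unfolding abs_mult by (intro mult_mono) auto
  have "\<bar>(sr - sl) / 2\<bar> \<le> 2 * M" using sl sr by (simp add: abs_le_iff)
  then have t4: "\<bar>(sr - sl) / 2 * s\<^sup>2\<bar> \<le> (2 * M) * (9 / 4)"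
    using s2 unfolding abs_mult by (intro mult_mono) auto
  have "\<bar>N\<bar> \<le> 11 * M"
  proof -
    have triangle: "\<bar>- p + q - r + s + t\<bar> \<le> \<bar>p\<bar> + \<bar>q\<bar> + \<bar>r\<bar> + \<bar>s\<bar> + \<bar>t\<bar>" for p q r s t :: real
      by linarith
    have "\<bar>N\<bar> \<le> \<bar>c0 * v0\<bar> + \<bar>(1 - c1) * v1\<bar> + \<bar>1 / 24 * (sr - sl)\<bar>
        + \<bar>(sr + sl - 2 * c1 * sl) / 2 * s\<bar> + \<bar>(sr - sl) / 2 * s\<^sup>2\<bar>"
      unfolding N_def mult_minus_left by (rule triangle)
    moreover have "\<bar>1 / 24 * (sr - sl)\<bar> \<le> M" using sl sr M0 by (simp add: abs_le_iff)
    ultimately show ?thesis using t1 t2 t3 t4 M0 by linarith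
  qed
  then have "\<bar>N\<bar> / c2 \<le> 11 * M / \<kappa>"
    using \<kappa> M0 by (intro frac_le) (auto simp: c2_def)
  then show ?thesis using P2 \<kappa> by (simp add: c2_def abs_divide)
qed

text \<open>Positivity for small \<open>h\<close> upgrades to a uniform lower bound because \<open>coef2\<close> has a positive
  limit: the limit is \<open>1\<close> if \<open>\<gamma>1 > 0\<close>, and \<open>1 - K1\<close> if \<open>\<gamma>1 = 0\<close>. In the latter case
  \<open>K1 < 1 - K0 h powr \<gamma>0 < 1\<close> for some \<open>h > 0\<close>.\<close>

lemma coef2_bounded_below:
  assumes K: "0 < K0" and gamma: "0 \<le> \<gamma>1" "0 < \<gamma>0"
    and pos: "\<forall>\<^sub>F h in at_right 0. 0 < coef2 K0 \<gamma>0 K1 \<gamma>1 h"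
  obtains \<kappa> where "0 < \<kappa>" "\<forall>\<^sub>F h in at_right 0. \<kappa> \<le> coef2 K0 \<gamma>0 K1 \<gamma>1 h"
proof -
  have powr_0: "((\<lambda>h. h powr \<gamma>) \<longlongrightarrow> 0) (at_right (0::real))" if "0 < \<gamma>" for \<gamma> :: real
  proof -
    have "((\<lambda>h. h powr \<gamma>) \<longlongrightarrow> 0 powr \<gamma>) (at_right (0::real))"
      using that by (intro tendsto_powr') (auto intro: tendsto_ident_at eventually_at_right_less
          eventually_mono[OF eventually_at_right_less])
    then show ?thesis by simp
  qed
  obtain L where L: "0 < L" "((\<lambda>h. coef2 K0 \<gamma>0 K1 \<gamma>1 h) \<longlongrightarrow> L) (at_right 0)"
  proof (cases "\<gamma>1 = 0")
    case True
    have "\<forall>\<^sub>F h in at_right 0. 0 < coef2 K0 \<gamma>0 K1 \<gamma>1 h \<and> 0 < h"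
      using pos eventually_at_right_less[of "0::real"] by (rule eventually_conj)
    then obtain h where h: "0 < coef2 K0 \<gamma>0 K1 \<gamma>1 h" "0 < h"
      using eventually_happens'[OF trivial_limit_at_right_real] by blast
    moreover have "0 < K0 * h powr \<gamma>0" using K h by simp
    ultimately have "0 < 1 - K1"
      using True by (simp add: coef2_def)
    have lim: "((\<lambda>h. 1 - K0 * h powr \<gamma>0 - K1) \<longlongrightarrow> 1 - K0 * 0 - K1) (at_right 0)"
      by (intro tendsto_intros powr_0 gamma)
    have "((\<lambda>h. coef2 K0 \<gamma>0 K1 \<gamma>1 h) \<longlongrightarrow> 1 - K0 * 0 - K1) (at_right 0)"
    proof (rule tendsto_cong[THEN iffD1, OF _ lim])
      show "\<forall>\<^sub>F h in at_right 0. 1 - K0 * h powr \<gamma>0 - K1 = coef2 K0 \<gamma>0 K1 \<gamma>1 h"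
        by (rule eventually_mono[OF eventually_at_right_less]) (use True in \<open>simp add: coef2_def\<close>)
    qed
    then have "((\<lambda>h. coef2 K0 \<gamma>0 K1 \<gamma>1 h) \<longlongrightarrow> 1 - K1) (at_right 0)" by simp
    with \<open>0 < 1 - K1\<close> show ?thesis by (rule that)
  next
    case False
    then have "0 < \<gamma>1" using gamma by simp
    then have "((\<lambda>h. coef2 K0 \<gamma>0 K1 \<gamma>1 h) \<longlongrightarrow> 1 - K0 * 0 - K1 * 0) (at_right 0)"
      unfolding coef2_def by (intro tendsto_intros powr_0 gamma)
    then show ?thesis by (intro that[of 1]) auto
  qed
  have "\<forall>\<^sub>F h in at_right 0. L / 2 < coef2 K0 \<gamma>0 K1 \<gamma>1 h"
    using L by (intro order_tendstoD(1)[OF L(2)]) simp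
  then have "\<forall>\<^sub>F h in at_right 0. L / 2 \<le> coef2 K0 \<gamma>0 K1 \<gamma>1 h" by (rule eventually_mono) simp
  then show ?thesis using that[of "L / 2"] L by simp
qed

section \<open>The combined reconstruction\<close>

text \<open>The constant depends only on the bounds for \<open>u\<close>, its derivatives, the weights and
  \<open>1 / c\<^sub>2\<close>, and not on the mesh or its position, so it serves for all small \<open>h\<close> at once.\<close>

lemma reconstruction_error:
  assumes h: "0 < h" "h \<le> 1" and k: "2 \<le> k"
    and T: "convex T" "T \<subseteq> {x0..x0 + 3 * h}" "{x0..<x0 + 2 * h} \<subseteq> T"
    and smooth: "Ck_bounded_on k B T u"
    and int: "u integrable_on cell x0 h (1 / 2)" "u integrable_on cell x0 h (3 / 2)"
    and M: "\<And>x. \<bar>u x\<bar> \<le> M"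
    and c: "0 < coef K0 \<gamma>0 h" "0 < coef K1 \<gamma>1 h" and \<kappa>: "0 < \<kappa>" "\<kappa> \<le> coef2 K0 \<gamma>0 K1 \<gamma>1 h"
    and w: "0 \<le> w0" "0 \<le> w1" "0 \<le> w2" "w0 + w1 + w2 = 1" "w0 \<le> C0 * h" "w2 \<le> C2 * h\<^sup>2"
    and x: "x \<in> T"
  shows "\<bar>u x - (w0 * P0 u x0 h x + w1 * P1 u x0 h x + w2 * P2 K0 \<gamma>0 K1 \<gamma>1 u x0 h x)\<bar>
    \<le> (21 * B * C0 + 45 * B + C2 * (M + 11 * M / \<kappa>)) * h\<^sup>2"
proof -
  obtain D where D: "Ck_derivs k T u D" and B: "\<forall>i\<le>k. \<forall>x\<in>T. \<bar>D i x\<bar> \<le> B"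
    using smooth by (auto simp: Ck_bounded_on_def)
  have x0: "x0 \<in> T" using T(3) h by auto
  have b: "\<bar>D 1 x0\<bar> \<le> B" using B x0 k by simp
  then have B0: "0 \<le> B" by linarith
  note tangent = tangent_line_error[OF k D B T(1,2) x0]
  have near: "\<forall>t\<in>{x0..<x0 + 2 * h}. \<bar>u t - (u x0 + D 1 x0 * (t - x0))\<bar> \<le> 9 * B * h\<^sup>2"
    using tangent T(3) by blast
  have x3: "x \<in> {x0..x0 + 3 * h}" using x T(2) by blast
  have "h\<^sup>2 \<le> h" using h by (simp add: power2_eq_square mult_left_le)
  then have "18 * B * h\<^sup>2 \<le> 18 * B * h" using B0 by (intro mult_left_mono) auto
  moreover have "3 * \<bar>D 1 x0\<bar> * h \<le> 3 * B * h" using b h by (intro mult_right_mono) auto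
  ultimately have e0: "\<bar>u x - P0 u x0 h x\<bar> \<le> 21 * B * h"
    using P0_error[OF h(1) int near x3 tangent[OF x]] by linarith
  have e1: "\<bar>u x - P1 u x0 h x\<bar> \<le> 45 * B * h\<^sup>2"
    using P1_error[OF h(1) int near x3 tangent[OF x]] by simp
  have e2: "\<bar>u x - P2 K0 \<gamma>0 K1 \<gamma>1 u x0 h x\<bar> \<le> M + 11 * M / \<kappa>"
    using P2_bound[where u = u, OF h(1) M x3 c \<kappa>] M[of x] by linarith
  have s0: "\<bar>w0 * (u x - P0 u x0 h x)\<bar> \<le> (C0 * h) * (21 * B * h)"
    using e0 w unfolding abs_mult by (intro mult_mono) auto
  have s1: "\<bar>w1 * (u x - P1 u x0 h x)\<bar> \<le> 1 * (45 * B * h\<^sup>2)"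
    using e1 w unfolding abs_mult by (intro mult_mono) auto
  have s2: "\<bar>w2 * (u x - P2 K0 \<gamma>0 K1 \<gamma>1 u x0 h x)\<bar> \<le> (C2 * h\<^sup>2) * (M + 11 * M / \<kappa>)"
    using e2 w unfolding abs_mult by (intro mult_mono) auto
  have "u x - (w0 * P0 u x0 h x + w1 * P1 u x0 h x + w2 * P2 K0 \<gamma>0 K1 \<gamma>1 u x0 h x)
     = (w0 + w1 + w2) * u x
       - (w0 * P0 u x0 h x + w1 * P1 u x0 h x + w2 * P2 K0 \<gamma>0 K1 \<gamma>1 u x0 h x)"
    using w by simp
  also have "\<dots> = w0 * (u x - P0 u x0 h x) + w1 * (u x - P1 u x0 h x)
       + w2 * (u x - P2 K0 \<gamma>0 K1 \<gamma>1 u x0 h x)"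
    by (simp add: algebra_simps)
  also have "\<bar>\<dots>\<bar> \<le> (C0 * h) * (21 * B * h) + 1 * (45 * B * h\<^sup>2)
       + (C2 * h\<^sup>2) * (M + 11 * M / \<kappa>)"
    using s0 s1 s2 by linarith
  also have "\<dots> = (21 * B * C0 + 45 * B + C2 * (M + 11 * M / \<kappa>)) * h\<^sup>2"
    by (simp add: power2_eq_square algebra_simps)
  finally show ?thesis .
qed

lemma Ck_bounded_on_imp_continuous_on:
  assumes "Ck_bounded_on k B S u" "0 < k"
  shows "continuous_on S u"
proof -
  obtain D where D: "\<And>x. x \<in> S \<Longrightarrow> D 0 x = u x"
      "\<And>x. x \<in> S \<Longrightarrow> (D 0 has_real_derivative D (Suc 0) x) (at x within S)"
    using assms by (auto simp: Ck_bounded_on_def Ck_derivs_def)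
  have "continuous_on S (D 0)" by (rule DERIV_continuous_on[OF D(2)])
  then show ?thesis using D(1) by (simp cong: continuous_on_cong)
qed

theorem theorem2p2:
  fixes u :: "real \<Rightarrow> real" and xs h0 :: real and x0 :: "real \<Rightarrow> real"
    and K0 K1 \<gamma>0 \<gamma>1 :: real and \<omega>0 \<omega>1 \<omega>2 :: "real \<Rightarrow> real" and k :: nat
    and P :: "real \<Rightarrow> real \<Rightarrow> real"
  assumes k: "2 \<le> k"
    and h0: "0 < h0"
    and K: "0 < K0" "0 < K1"
    and gamma: "0 \<le> \<gamma>0" "0 \<le> \<gamma>1" "\<gamma>1 \<le> \<gamma>0" "1 \<le> \<gamma>0"
    and c_pos: "\<forall>\<^sub>F h in at_right 0.
        0 < coef K0 \<gamma>0 h \<and> 0 < coef K1 \<gamma>1 h \<and> 0 < coef2 K0 \<gamma>0 K1 \<gamma>1 h"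
    and bounded: "bounded (range u)"
    and jump: "single_jump_at k u xs"
    and grid: "\<And>h. h \<in> {0<..<h0} \<Longrightarrow> xs \<in> cell (x0 h) h (5 / 2)"
    and smooth: "uniformly_Ck_on k h0 (\<lambda>h. stencil 1 (x0 h) h) u"
    and weights_nonneg: "\<And>h. h \<in> {0<..<h0} \<Longrightarrow> 0 \<le> \<omega>0 h \<and> 0 \<le> \<omega>1 h \<and> 0 \<le> \<omega>2 h"
    and weights_sum: "\<And>h. h \<in> {0<..<h0} \<Longrightarrow> \<omega>0 h + \<omega>1 h + \<omega>2 h = 1"
    and weights_order: "\<omega>0 \<in> O[at_right 0](\<lambda>h. h)" "\<omega>1 \<in> O[at_right 0](\<lambda>h. 1)"
      "\<omega>2 \<in> O[at_right 0](\<lambda>h. h\<^sup>2)"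
    and P: "\<And>h x. P h x = \<omega>0 h * P0 u (x0 h) h x + \<omega>1 h * P1 u (x0 h) h x
        + \<omega>2 h * P2 K0 \<gamma>0 K1 \<gamma>1 u (x0 h) h x"
  shows "(\<exists>C. \<forall>\<^sub>F h in at_right 0. \<forall>x\<in>stencil 1 (x0 h) h. \<bar>u x - P h x\<bar> \<le> C * h\<^sup>2) \<and>
    (uniformly_Ck_on k h0 (\<lambda>h. {x0 h..<xs}) u \<longrightarrow>
      (\<exists>C. \<forall>\<^sub>F h in at_right 0. \<forall>x\<in>{x0 h..<xs}. \<bar>u x - P h x\<bar> \<le> C * h\<^sup>2))"
proof -
  obtain M where M: "\<And>x. \<bar>u x\<bar> \<le> M"
    using bounded by (auto simp: bounded_iff)
  obtain C0 where C0: "\<forall>\<^sub>F h in at_right 0. norm (\<omega>0 h) \<le> C0 * norm h"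
    using weights_order(1) by (elim landau_o.bigE)
  obtain C2 where C2: "\<forall>\<^sub>F h in at_right 0. norm (\<omega>2 h) \<le> C2 * norm (h\<^sup>2)"
    using weights_order(3) by (elim landau_o.bigE)
  obtain \<kappa> where \<kappa>: "0 < \<kappa>" "\<forall>\<^sub>F h in at_right 0. \<kappa> \<le> coef2 K0 \<gamma>0 K1 \<gamma>1 h"
    using coef2_bounded_below[of K0 \<gamma>1 \<gamma>0 K1] K gamma eventually_mono[OF c_pos] by auto
  have small: "\<forall>\<^sub>F h in at_right 0. h \<in> {0<..<min 1 h0}"
    using h0 by (intro eventually_at_right_real) auto
  obtain B1 where B1: "\<And>h. h \<in> {0<..<h0} \<Longrightarrow> Ck_bounded_on k B1 (stencil 1 (x0 h) h) u"
    using smooth unfolding uniformly_Ck_on_def by blast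
  have main: "\<exists>C. \<forall>\<^sub>F h in at_right 0. \<forall>x\<in>T h. \<bar>u x - P h x\<bar> \<le> C * h\<^sup>2"
    if unif: "uniformly_Ck_on k h0 T u"
      and T: "\<And>h. h \<in> {0<..<h0} \<Longrightarrow>
        convex (T h) \<and> T h \<subseteq> {x0 h..x0 h + 3 * h} \<and> {x0 h..<x0 h + 2 * h} \<subseteq> T h"
    for T :: "real \<Rightarrow> real set"
  proof -
    obtain B where B: "\<And>h. h \<in> {0<..<h0} \<Longrightarrow> Ck_bounded_on k B (T h) u"
      using unif unfolding uniformly_Ck_on_def by blast
    have "\<forall>\<^sub>F h in at_right 0. \<forall>x\<in>T h. \<bar>u x - P h x\<bar>
        \<le> (21 * B * C0 + 45 * B + C2 * (M + 11 * M / \<kappa>)) * h\<^sup>2"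
      using C0 C2 \<kappa>(2) c_pos small
    proof eventually_elim
      case (elim h)
      then have hh: "h \<in> {0<..<h0}" and h: "0 < h" "h \<le> 1" by auto
      have cont: "continuous_on {x0 h..x0 h + 2 * h} u"
        using Ck_bounded_on_imp_continuous_on[OF B1[OF hh]] k
        unfolding stencil_1_eq[OF h(1)] by simp
      have int: "u integrable_on cell (x0 h) h (1 / 2)" "u integrable_on cell (x0 h) h (3 / 2)"
        unfolding cell_half_integer using h
        by (auto intro!: integrable_continuous_real continuous_on_subset[OF cont])
      have w: "0 \<le> \<omega>0 h" "0 \<le> \<omega>1 h" "0 \<le> \<omega>2 h" "\<omega>0 h + \<omega>1 h + \<omega>2 h = 1"
          "\<omega>0 h \<le> C0 * h" "\<omega>2 h \<le> C2 * h\<^sup>2"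
        using weights_nonneg[OF hh] weights_sum[OF hh] elim(1,2) h by auto
      have T': "convex (T h)" "T h \<subseteq> {x0 h..x0 h + 3 * h}" "{x0 h..<x0 h + 2 * h} \<subseteq> T h"
        using T[OF hh] by auto
      have c: "0 < coef K0 \<gamma>0 h" "0 < coef K1 \<gamma>1 h" using elim(4) by auto
      show ?case
        unfolding P using reconstruction_error[where u = u, OF h k T' B[OF hh] int M c \<kappa>(1) elim(3) w]
        by blast
    qed
    then show ?thesis by blast
  qed
  show ?thesis
  proof (intro conjI impI)
    show "\<exists>C. \<forall>\<^sub>F h in at_right 0. \<forall>x\<in>stencil 1 (x0 h) h. \<bar>u x - P h x\<bar> \<le> C * h\<^sup>2"
      using smooth by (rule main) (auto simp: stencil_1_eq simp del: One_nat_def)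
  next
    assume "uniformly_Ck_on k h0 (\<lambda>h. {x0 h..<xs}) u"
    then show "\<exists>C. \<forall>\<^sub>F h in at_right 0. \<forall>x\<in>{x0 h..<xs}. \<bar>u x - P h x\<bar> \<le> C * h\<^sup>2"
    proof (rule main)
      fix h assume "h \<in> {0<..<h0}"
      then have "x0 h + 2 * h \<le> xs" "xs \<le> x0 h + 3 * h"
        using grid[of h] by (simp_all add: cell_half_integer)
      then show "convex {x0 h..<xs} \<and> {x0 h..<xs} \<subseteq> {x0 h..x0 h + 3 * h}
          \<and> {x0 h..<x0 h + 2 * h} \<subseteq> {x0 h..<xs}"
        by auto
    qed
  qed
qed

end
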